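(* Let $S$ be a $*$-monoid and let $a\in S$. Then the following conditions are equivalent: (i) $a$ is left g-MP invertible; (ii) $aa^*$ is left invertible along $a$; (iii) there exists $b\in S$ such that $baa^*a=a$ and $Sb\subseteq Sa$. In this case, $yxa$ is a left inverse of $aa^*$ along $a$ for all $x,y\in S$ such that $a=xa^2=yaa^*a$, and $baa^*b$ is a left inverse of $aa^*$ along $a$ for any $b$ as in (iii).
   Context: A $*$-monoid is a monoid $S$ with a map $*:S\to S$ satisfying $(x^* )^*=x$ and $(xy)^*=y^*x^*$ for all $x,y\in S$. An element $a\in S$ is left g-MP invertible if $Sa=Sa^2=Saa^*a$. For $a,b\in S$, write $a\leq_{\mathcal L}b$ if $Sa\subseteq Sb$, equivalently $a=xb$ for some $x\in S$. For $c,d\in S$, an element $b\in S$ is a left inverse of $c$ along $d$ if $bcd=d$ and $b\leq_{\mathcal L}d$; $c$ is left invertible along $d$ if such a $b$ exists. *)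

theory Defs
  imports Main
begin

class star_monoid = monoid_mult +
  fixes star :: "'a \<Rightarrow> 'a"  ("_\<^sup>\<star>" [1000] 999)
  assumes star_star: "(x\<^sup>\<star>)\<^sup>\<star> = x"
    and star_mult: "(x * y)\<^sup>\<star> = y\<^sup>\<star> * x\<^sup>\<star>"

text \<open>The principal left ideal \<open>S a\<close>, where the monoid \<open>S\<close> is the whole type.\<close>

definition left_ideal :: "'a::monoid_mult \<Rightarrow> 'a set" where
  "left_ideal a = {s * a | s. True}"

definition left_gMP_invertible :: "'a::star_monoid \<Rightarrow> bool" where
  "left_gMP_invertible a \<longleftrightarrow>
     left_ideal a = left_ideal (a\<^sup>2) \<and> left_ideal (a\<^sup>2) = left_ideal (a * a\<^sup>\<star> * a)"

definition leq_L :: "'a::monoid_mult \<Rightarrow> 'a \<Rightarrow> bool"  (infix "\<le>\<^sub>L" 50) where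
  "a \<le>\<^sub>L b \<longleftrightarrow> left_ideal a \<subseteq> left_ideal b"

lemma leq_L_iff: "a \<le>\<^sub>L b \<longleftrightarrow> (\<exists>x. a = x * b)"
proof
  assume "a \<le>\<^sub>L b"
  moreover have "a \<in> left_ideal a"
    unfolding left_ideal_def by (auto intro: exI[of _ 1])
  ultimately show "\<exists>x. a = x * b"
    unfolding leq_L_def left_ideal_def by auto
next
  assume "\<exists>x. a = x * b"
  then obtain x where "a = x * b" ..
  then have "s * a = (s * x) * b" for s
    by (simp add: mult.assoc)
  then show "a \<le>\<^sub>L b"
    unfolding leq_L_def left_ideal_def by blast
qed

text \<open>\<open>left_inverse_along b c d\<close>: \<open>b\<close> is a left inverse of \<open>c\<close> along \<open>d\<close>.\<close>

definition left_inverse_along :: "'a::monoid_mult \<Rightarrow> 'a \<Rightarrow> 'a \<Rightarrow> bool" where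
  "left_inverse_along b c d \<longleftrightarrow> b * c * d = d \<and> b \<le>\<^sub>L d"

definition left_invertible_along :: "'a::monoid_mult \<Rightarrow> 'a \<Rightarrow> bool" where
  "left_invertible_along c d \<longleftrightarrow> (\<exists>b. left_inverse_along b c d)"

end

theory Submission
  imports Defs
begin

text \<open>The substantial implication is (iii) to (i). If \<open>b a a\<^sup>\<star> a = a\<close>, then \<open>p = b a a\<^sup>\<star>\<close> is
  a projection with \<open>p a = a\<close>, and \<open>z = b a a\<^sup>\<star> b\<^sup>\<star>\<close> acts as an inverse of \<open>a a\<^sup>\<star>\<close> on \<open>a\<close>. This
  forces \<open>a a\<^sup>\<star> b a = a\<close>, so \<open>b = u a\<close> yields \<open>a = (a a\<^sup>\<star> u) a\<^sup>2\<close>.\<close>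

lemma left_ideal_subset_iff: "left_ideal a \<subseteq> left_ideal b \<longleftrightarrow> (\<exists>x. a = x * b)"
  using leq_L_iff unfolding leq_L_def .

text \<open>The generators \<open>a\<^sup>2\<close> and \<open>a * a\<^sup>\<star> * a\<close> are
  left multiples of \<open>a\<close>, so only the inclusions of \<open>left_ideal a\<close> in their
  ideals carry information; \<open>x\<close> and \<open>y\<close> witness these.\<close>

lemma left_gMP_invertible_iff:
  "left_gMP_invertible a \<longleftrightarrow> (\<exists>x y. a = x * a\<^sup>2 \<and> a = y * a * a\<^sup>\<star> * a)"
proof
  assume "left_gMP_invertible a"
  then have "left_ideal a \<subseteq> left_ideal (a\<^sup>2)" "left_ideal a \<subseteq> left_ideal (a * a\<^sup>\<star> * a)"
    unfolding left_gMP_invertible_def by auto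
  then show "\<exists>x y. a = x * a\<^sup>2 \<and> a = y * a * a\<^sup>\<star> * a"
    unfolding left_ideal_subset_iff by (metis mult.assoc)
next
  assume "\<exists>x y. a = x * a\<^sup>2 \<and> a = y * a * a\<^sup>\<star> * a"
  then have "left_ideal a \<subseteq> left_ideal (a\<^sup>2)" "left_ideal a \<subseteq> left_ideal (a * a\<^sup>\<star> * a)"
    unfolding left_ideal_subset_iff by (metis mult.assoc)+
  moreover have "left_ideal (a\<^sup>2) \<subseteq> left_ideal a" "left_ideal (a * a\<^sup>\<star> * a) \<subseteq> left_ideal a"
    unfolding left_ideal_subset_iff by (auto simp: power2_eq_square)
  ultimately show "left_gMP_invertible a"
    unfolding left_gMP_invertible_def by blast
qed

lemma left_inverse_along_star_iff:
  "left_inverse_along b (a * a\<^sup>\<star>) a \<longleftrightarrow> b * a * a\<^sup>\<star> * a = a \<and> left_ideal b \<subseteq> left_ideal a"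
  unfolding left_inverse_along_def leq_L_def by (simp add: mult.assoc)

text \<open>Moves \<open>b\<close> to the right of \<open>a * a\<^sup>\<star>\<close>, so that a
  factorization \<open>b = u * a\<close> puts \<open>a\<^sup>2\<close> at the right end.\<close>

lemma mult_star_mult_eq_self:
  fixes a b :: "'a::star_monoid"
  assumes b: "b * a * a\<^sup>\<star> * a = a"
  shows "a * a\<^sup>\<star> * b * a = a"
proof -
  define p where "p = b * a * a\<^sup>\<star>"
  \<comment> \<open>Here \<open>z = p * b\<^sup>\<star>\<close>; the factor \<open>p\<close> is
    absorbed by \<open>a\<^sup>\<star>\<close>, and what remains of
    \<open>a * a\<^sup>\<star> * z\<close> is \<open>p\<^sup>\<star>\<close>.\<close>
  define z where "z = b * a * a\<^sup>\<star> * b\<^sup>\<star>"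
  have pa: "p * a = a"
    using b by (simp add: p_def)
  have p_star: "p\<^sup>\<star> = a * a\<^sup>\<star> * b\<^sup>\<star>"
    by (simp add: p_def star_mult star_star mult.assoc)
  \<comment> \<open>\<open>p\<^sup>\<star>\<close> begins with \<open>a\<close>, which
    \<open>p\<close> fixes from the left. Since \<open>p * p\<^sup>\<star>\<close> is its own star,
    so is \<open>p\<^sup>\<star>\<close>.\<close>
  have "p * p\<^sup>\<star> = p\<^sup>\<star>"
    unfolding p_star by (metis pa mult.assoc)
  then have p_sym: "p\<^sup>\<star> = p"
    by (metis star_mult star_star)
  have ap: "a\<^sup>\<star> * p = a\<^sup>\<star>"
    by (metis pa p_sym star_mult)
  have "a * a\<^sup>\<star> * z = a * (a\<^sup>\<star> * p) * b\<^sup>\<star>"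
    by (simp add: z_def p_def mult.assoc)
  also have "\<dots> = p"
    using p_star p_sym ap by simp
  finally have az: "a * a\<^sup>\<star> * z = p" .
  \<comment> \<open>Rewriting the last \<open>a\<close> as \<open>p * a\<close> with
    \<open>p = a * a\<^sup>\<star> * z\<close> creates the block
    \<open>b * a * a\<^sup>\<star> = p\<close> next to \<open>a\<^sup>\<star>\<close>, which absorbs
    it.\<close>
  have "a * a\<^sup>\<star> * b * a = a * a\<^sup>\<star> * b * (a * a\<^sup>\<star> * z * a)"
    by (simp add: az pa)
  also have "\<dots> = a * (a\<^sup>\<star> * p) * z * a"
    by (simp add: p_def mult.assoc)
  also have "\<dots> = a"
    by (simp add: ap az pa)
  finally show ?thesis .
qed

lemma left_gMP_invertible_if_left_inverse_along:
  assumes "left_inverse_along b (a * a\<^sup>\<star>) a"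
  shows "left_gMP_invertible a"
proof -
  have b: "b * a * a\<^sup>\<star> * a = a"
    using assms by (simp add: left_inverse_along_star_iff)
  obtain u where "b = u * a"
    using assms unfolding left_inverse_along_star_iff left_ideal_subset_iff by blast
  then have "a = (a * a\<^sup>\<star> * u) * a\<^sup>2"
    using mult_star_mult_eq_self[OF b] by (simp add: power2_eq_square mult.assoc)
  \<comment> \<open>The second factorization is the equation for \<open>b\<close> itself, with
    \<open>y = b\<close>.\<close>
  then show ?thesis
    using b unfolding left_gMP_invertible_iff by metis
qed

text \<open>The product collapses from the inside: \<open>x * a\<^sup>2\<close> becomes
  \<open>a\<close>, and then the factorization through \<open>y\<close> applies. Membership in the
  left ideal of \<open>a\<close> is visible from the last factor.\<close>

lemma left_inverse_along_if_factorizations: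
  assumes x: "a = x * a\<^sup>2" and y: "a = y * a * a\<^sup>\<star> * a"
  shows "left_inverse_along (y * x * a) (a * a\<^sup>\<star>) a"
proof -
  have "y * x * a * a * a\<^sup>\<star> * a = y * (x * a\<^sup>2) * a\<^sup>\<star> * a"
    by (simp add: power2_eq_square mult.assoc)
  also have "\<dots> = a"
    by (simp flip: x y)
  finally show ?thesis
    unfolding left_inverse_along_star_iff left_ideal_subset_iff by blast
qed

text \<open>Left multiplication by \<open>b * a * a\<^sup>\<star>\<close> fixes \<open>a\<close>,
  hence so does applying it twice; the trailing \<open>b\<close> keeps the product in the left ideal
  of \<open>a\<close>.\<close>

lemma left_inverse_along_mult_self:
  assumes "left_inverse_along b (a * a\<^sup>\<star>) a"
  shows "left_inverse_along (b * a * a\<^sup>\<star> * b) (a * a\<^sup>\<star>) a"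
proof -
  have b: "b * a * a\<^sup>\<star> * a = a"
    using assms by (simp add: left_inverse_along_star_iff)
  obtain u where u: "b = u * a"
    using assms unfolding left_inverse_along_star_iff left_ideal_subset_iff by blast
  have "b * a * a\<^sup>\<star> * b * a * a\<^sup>\<star> * a = b * a * a\<^sup>\<star> * (b * a * a\<^sup>\<star> * a)"
    by (simp add: mult.assoc)
  also have "\<dots> = a"
    by (simp add: b)
  finally have "b * a * a\<^sup>\<star> * b * a * a\<^sup>\<star> * a = a" .
  moreover have "b * a * a\<^sup>\<star> * b = (b * a * a\<^sup>\<star> * u) * a"
    by (simp add: u mult.assoc)
  ultimately show ?thesis
    unfolding left_inverse_along_star_iff left_ideal_subset_iff by blast
qed

theorem theorem2p10:
  fixes a :: "'a::star_monoid"
  shows "(left_gMP_invertible a \<longleftrightarrow> left_invertible_along (a * a\<^sup>\<star>) a)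
    \<and> (left_invertible_along (a * a\<^sup>\<star>) a
         \<longleftrightarrow> (\<exists>b. b * a * a\<^sup>\<star> * a = a \<and> left_ideal b \<subseteq> left_ideal a))
    \<and> (left_gMP_invertible a \<longrightarrow>
         (\<forall>x y. a = x * a\<^sup>2 \<and> x * a\<^sup>2 = y * a * a\<^sup>\<star> * a \<longrightarrow>
            left_inverse_along (y * x * a) (a * a\<^sup>\<star>) a)
       \<and> (\<forall>b. b * a * a\<^sup>\<star> * a = a \<and> left_ideal b \<subseteq> left_ideal a \<longrightarrow>
            left_inverse_along (b * a * a\<^sup>\<star> * b) (a * a\<^sup>\<star>) a))"
proof (intro conjI impI allI)
  show "left_gMP_invertible a \<longleftrightarrow> left_invertible_along (a * a\<^sup>\<star>) a"
    unfolding left_invertible_along_def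
    by (metis left_gMP_invertible_if_left_inverse_along left_gMP_invertible_iff
        left_inverse_along_if_factorizations)
  \<comment> \<open>Condition (iii) is the definition of a left inverse along \<open>a\<close>
    written out, with the same witness \<open>b\<close>.\<close>
  show "left_invertible_along (a * a\<^sup>\<star>) a
      \<longleftrightarrow> (\<exists>b. b * a * a\<^sup>\<star> * a = a \<and> left_ideal b \<subseteq> left_ideal a)"
    unfolding left_invertible_along_def left_inverse_along_star_iff ..
next
  fix x y
  assume "a = x * a\<^sup>2 \<and> x * a\<^sup>2 = y * a * a\<^sup>\<star> * a"
  then show "left_inverse_along (y * x * a) (a * a\<^sup>\<star>) a"
    by (metis left_inverse_along_if_factorizations)
next
  fix b
  assume "b * a * a\<^sup>\<star> * a = a \<and> left_ideal b \<subseteq> left_ideal a"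
  then show "left_inverse_along (b * a * a\<^sup>\<star> * b) (a * a\<^sup>\<star>) a"
    by (intro left_inverse_along_mult_self) (simp add: left_inverse_along_star_iff)
qed

end
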